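(* Let $(M,+)$ be a unital magma with neutral element $\mathbf 0$ and with the two-sided cancellation property. Let $f:[0,\infty)\to M$ be non-zero (i.e. $f\not\equiv\mathbf 0$), let $h:[0,\infty)\to[0,\infty)$ be such that $\mathrm{Ker}(h):=\{s\in[0,\infty): h(s)=0\}\neq\emptyset$, and put $s_0=\inf \mathrm{Ker}(h)$. Then $$f(s+t)=f(s)+f(h(s)t)\qquad\text{for all } s,t\in[0,\infty)$$ if and only if one of the following holds: 1. $s_0=0$ and there are $\mathbf a\in M\setminus\{\mathbf 0\}$ and $b\in(0,\infty)$ such that $$f(s)=\begin{cases}\mathbf 0, & s=0,\\ \mathbf a, & s\in(0,\infty),\end{cases}\qquad h(s)=\begin{cases} b, & s=0,\\ 0, & s\in(0,\infty);\end{cases}$$ 2. $s_0>0$ and there is $\mathbf a\in M\setminus\{\mathbf 0\}$ such that $$f(s)=\begin{cases}\mathbf 0, & s\in[0,s_0),\\ \mathbf a, & s\in[s_0,\infty),\end{cases}\qquad h(s)=\begin{cases} \frac{s_0}{s_0-s}, & s\in[0,s_0),\\ 0, & s\in[s_0,\infty).\end{cases}$$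
   Context: A magma $(M,+)$ is a set $M$ with a binary operation $+:M\times M\to M$ (no associativity or commutativity is assumed). It is unital if there is an element $\mathbf 0\in M$ with $\mathbf a+\mathbf 0=\mathbf 0+\mathbf a=\mathbf a$ for all $\mathbf a\in M$. It has the two-sided cancellation property if $\mathbf a+\mathbf b=\mathbf a+\mathbf c$ implies $\mathbf b=\mathbf c$, and $\mathbf b+\mathbf a=\mathbf c+\mathbf a$ implies $\mathbf b=\mathbf c$, for all $\mathbf a,\mathbf b,\mathbf c\in M$. *)

theory Defs
  imports Complex_Main "HOL-Library.FuncSet"
begin

locale magma =
  fixes M :: "'a set"
    and add :: "'a \<Rightarrow> 'a \<Rightarrow> 'a" (infixl \<open>\<oplus>\<close> 65)
  assumes add_closed: "\<lbrakk>a \<in> M; b \<in> M\<rbrakk> \<Longrightarrow> a \<oplus> b \<in> M"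

locale unital_magma = magma M add
  for M :: "'a set"
    and add :: "'a \<Rightarrow> 'a \<Rightarrow> 'a" (infixl \<open>\<oplus>\<close> 65) +
  fixes neutral :: 'a (\<open>\<zero>\<close>)
  assumes neutral_closed: "\<zero> \<in> M"
    and right_neutral: "a \<in> M \<Longrightarrow> a \<oplus> \<zero> = a"
    and left_neutral: "a \<in> M \<Longrightarrow> \<zero> \<oplus> a = a"

locale cancellative_magma = magma M add
  for M :: "'a set"
    and add :: "'a \<Rightarrow> 'a \<Rightarrow> 'a" (infixl \<open>\<oplus>\<close> 65) +
  assumes left_cancel: "\<lbrakk>a \<in> M; b \<in> M; c \<in> M; a \<oplus> b = a \<oplus> c\<rbrakk> \<Longrightarrow> b = c"
    and right_cancel: "\<lbrakk>a \<in> M; b \<in> M; c \<in> M; b \<oplus> a = c \<oplus> a\<rbrakk> \<Longrightarrow> b = c"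

text \<open>
  Functions on \<open>[0,\<infinity>)\<close> are rendered as total functions on the reals of which only the
  restriction to \<open>{0..}\<close> matters.
\<close>

definition Ker :: "(real \<Rightarrow> real) \<Rightarrow> real set" where
  "Ker h = {s \<in> {0..}. h s = 0}"

end

theory Submission
  imports Defs
begin

text \<open>
  If \<open>h s = 0\<close>, then \<open>f\<close> is constant on \<open>[s, \<infinity>)\<close>, so \<open>f\<close> is eventually equal to some \<open>a\<close>. If
  \<open>h s > 0\<close>, letting \<open>t\<close> be large gives \<open>a = f s \<oplus> a\<close>, hence \<open>f s = \<zero>\<close>. So \<open>f\<close> is \<open>a\<close> on the kernel
  of \<open>h\<close> and \<open>\<zero>\<close> off it, and the equation becomes a statement about the kernel alone: it is an
  up-set, and for \<open>s\<close> outside it, \<open>s + t\<close> lies in it iff \<open>h s * t\<close> does. Comparing the infima of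
  the two sets of admissible \<open>t\<close> gives \<open>s0 - s = s0 / h s\<close>.
\<close>

lemma Ker_iff: "s \<in> Ker h \<longleftrightarrow> 0 \<le> s \<and> h s = 0"
  by (simp add: Ker_def)

lemma Inf_Ker_nonneg: "Ker h \<noteq> {} \<Longrightarrow> 0 \<le> Inf (Ker h)"
  by (rule cInf_greatest) (auto simp: Ker_iff)

lemma Inf_Ker_le: "s \<in> Ker h \<Longrightarrow> Inf (Ker h) \<le> s"
  by (rule cInf_lower) (auto simp: Ker_iff intro: bdd_belowI[of _ 0])

text \<open>The up-set property only places \<open>Ker h\<close> between the open and the closed ray
  starting at \<open>s0\<close>. Whether \<open>s0\<close> belongs to it is decided by
  \<open>zero\<close> if \<open>s0 = 0\<close>, and by the scaling relation if
  \<open>s0 > 0\<close>.\<close>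

lemma Ker_shape:
  fixes h :: "real \<Rightarrow> real"
  defines "s0 \<equiv> Inf (Ker h)"
  assumes nonneg: "\<And>s. 0 \<le> s \<Longrightarrow> 0 \<le> h s"
    and nonempty: "Ker h \<noteq> {}"
    and up: "\<And>s t. s \<in> Ker h \<Longrightarrow> s \<le> t \<Longrightarrow> t \<in> Ker h"
    and scale: "\<And>s t. 0 \<le> s \<Longrightarrow> 0 \<le> t \<Longrightarrow> h s \<noteq> 0 \<Longrightarrow> s + t \<in> Ker h \<longleftrightarrow> h s * t \<in> Ker h"
    and zero: "h 0 \<noteq> 0"
  shows "s0 = 0 \<Longrightarrow> 0 \<le> s \<Longrightarrow> h s = 0 \<longleftrightarrow> s \<noteq> 0"
    and "0 < s0 \<Longrightarrow> 0 \<le> s \<Longrightarrow> h s = (if s < s0 then s0 / (s0 - s) else 0)"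
proof -
  have above: "x \<in> Ker h" if "s0 < x" for x
    using that nonempty up unfolding s0_def by (meson cInf_lessD less_imp_le)
  have below: "s0 \<le> x" if "x \<in> Ker h" for x
    using that unfolding s0_def by (rule Inf_Ker_le)
  show "h s = 0 \<longleftrightarrow> s \<noteq> 0" if "s0 = 0" "0 \<le> s" for s
    using above[of s] that zero by (auto simp: Ker_iff)
  show "h s = (if s < s0 then s0 / (s0 - s) else 0)" if s0: "0 < s0" and s: "0 \<le> s" for s
  proof -
    have off: "s < s0 \<and> h s * (s0 - s) = s0" if hs: "h s \<noteq> 0"
    proof -
      have pos: "0 < h s"
        using nonneg[OF s] hs by simp
      have lower: "s0 \<le> s + t" if "s0 / h s < t" for t
      proof (rule below)
        have "0 < s0 / h s"
          using s0 pos by simp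
        then have "0 \<le> t"
          using that by linarith
        then show "s + t \<in> Ker h"
          using that pos scale[of s t] above[of "h s * t"] s hs by (simp add: field_simps)
      qed
      have upper: "s0 / h s \<le> t" if "s0 < s + t" "0 \<le> t" for t
        using that pos scale[of s t] above[of "s + t"] below[of "h s * t"] s hs
        by (simp add: field_simps)
      \<comment> \<open>This makes every \<open>t > s0 - s\<close> nonnegative, as
        \<open>upper\<close> demands.\<close>
      have "s \<le> s0"
        using above[of s] hs by (force simp: Ker_iff)
      \<comment> \<open>Membership of \<open>s0\<close> in \<open>Ker h\<close> is still open, so
        \<open>lower\<close> and \<open>upper\<close> assume strict inequalities; density of the
        reals recovers the bound at the endpoint in both directions.\<close>
      moreover have "s0 - s \<le> s0 / h s"
      proof (rule dense_ge)
        show "s0 - s \<le> t" if "s0 / h s < t" for t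
          using lower[OF that] by simp
      qed
      moreover have "s0 / h s \<le> s0 - s"
      proof (rule dense_ge)
        show "s0 / h s \<le> t" if "s0 - s < t" for t
          using upper[of t] that \<open>s \<le> s0\<close> by simp
      qed
      ultimately have "s0 - s = s0 / h s"
        by simp
      \<comment> \<open>Positivity turns \<open>s \<le> s0\<close> into \<open>s < s0\<close>: the
        point \<open>s0\<close> cannot lie off the kernel.\<close>
      moreover have "0 < s0 / h s"
        using s0 pos by simp
      ultimately show ?thesis
        using hs by simp
    qed
    show ?thesis
    proof (cases "h s = 0")
      case True
      then show ?thesis
        using below[of s] s by (simp add: Ker_iff)
    next
      case False
      then show ?thesis
        using off by (simp add: eq_divide_eq)
    qed
  qed
qed

lemma equation_imp_two_valued:
  fixes add :: "'a \<Rightarrow> 'a \<Rightarrow> 'a" (infixl \<open>\<oplus>\<close> 65)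
    and neutral :: 'a (\<open>\<zero>\<close>)
    and h :: "real \<Rightarrow> real"
  assumes "unital_magma M (\<oplus>) \<zero>" and "cancellative_magma M (\<oplus>)"
    and f: "\<And>s. 0 \<le> s \<Longrightarrow> f s \<in> M"
    and h: "\<And>s. 0 \<le> s \<Longrightarrow> 0 \<le> h s"
    and nonempty: "Ker h \<noteq> {}"
    and eq: "\<And>s t. 0 \<le> s \<Longrightarrow> 0 \<le> t \<Longrightarrow> f (s + t) = f s \<oplus> f (h s * t)"
  obtains a where "a \<in> M" "\<And>s. 0 \<le> s \<Longrightarrow> f s = (if s \<in> Ker h then a else \<zero>)" "f 0 = \<zero>"
proof -
  interpret unital_magma M "(\<oplus>)" \<zero> by fact
  interpret cancellative_magma M "(\<oplus>)" by fact
  \<comment> \<open>At \<open>s = t = 0\<close> the argument \<open>h 0 * 0\<close> vanishes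
    whatever \<open>h 0\<close> is, so \<open>f 0 = f 0 \<oplus> f 0\<close> and left cancellation
    applies.\<close>
  have f0: "f 0 = \<zero>"
    using left_cancel[of "f 0" "f 0" \<zero>] eq[of 0 0] f[of 0] neutral_closed right_neutral by simp
  obtain k where k: "k \<in> Ker h"
    using nonempty by blast
  have const: "f t = f s" if "s \<in> Ker h" "s \<le> t" for s t
    using eq[of s "t - s"] that f0 right_neutral f by (simp add: Ker_iff)
  have on: "f s = f k" if "s \<in> Ker h" for s
    using const[OF that, of "max s k"] const[OF k, of "max s k"] by simp
  have off: "f s = \<zero>" if s: "0 \<le> s" "s \<notin> Ker h" for s
  proof -
    have pos: "0 < h s"
      using s h[of s] by (simp add: Ker_iff)
    \<comment> \<open>The first summand brings \<open>s + t\<close> past \<open>k\<close>, the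
      second brings \<open>h s * t\<close> past \<open>k\<close>; there \<open>f\<close> is
      constant.\<close>
    define t where "t = k + k / h s"
    have "0 \<le> k"
      using k by (simp add: Ker_iff)
    with s pos have t: "k \<le> s + t" "k \<le> h s * t" "0 \<le> t"
      by (simp_all add: t_def distrib_left)
    then have "f k = f s \<oplus> f k"
      using eq[of s t] const[OF k, of "s + t"] const[OF k, of "h s * t"] s by simp
    with \<open>0 \<le> k\<close> show ?thesis
      using right_cancel[of "f k" "f s" \<zero>] f[of s] f[of k] s left_neutral neutral_closed
      by simp
  qed
  show thesis
  proof (rule that)
    show "f k \<in> M"
      using f k by (simp add: Ker_iff)
    show "f s = (if s \<in> Ker h then f k else \<zero>)" if "0 \<le> s" for s
      using on[of s] off[OF that] by (cases "s \<in> Ker h") simp_all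
  qed (rule f0)
qed

theorem theorem3p1:
  fixes M :: "'a set"
    and add :: "'a \<Rightarrow> 'a \<Rightarrow> 'a" (infixl \<open>\<oplus>\<close> 65)
    and neutral :: 'a (\<open>\<zero>\<close>)
    and f :: "real \<Rightarrow> 'a"
    and h :: "real \<Rightarrow> real"
    and s0 :: real
  assumes "unital_magma M (\<oplus>) \<zero>"
    and "cancellative_magma M (\<oplus>)"
    and "f \<in> {0..} \<rightarrow> M"
    and "\<exists>s\<in>{0..}. f s \<noteq> \<zero>"
    and "h \<in> {0..} \<rightarrow> {0..}"
    and "Ker h \<noteq> {}"
    and "s0 = Inf (Ker h)"
  shows "(\<forall>s\<in>{0..}. \<forall>t\<in>{0..}. f (s + t) = f s \<oplus> f (h s * t)) \<longleftrightarrow>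
    (s0 = 0 \<and> (\<exists>a\<in>M - {\<zero>}. \<exists>b\<in>{0<..}. \<forall>s\<in>{0..}.
        f s = (if s = 0 then \<zero> else a) \<and>
        h s = (if s = 0 then b else 0)))
    \<or> (s0 > 0 \<and> (\<exists>a\<in>M - {\<zero>}. \<forall>s\<in>{0..}.
        f s = (if s < s0 then \<zero> else a) \<and>
        h s = (if s < s0 then s0 / (s0 - s) else 0)))"
proof -
  interpret unital_magma M "(\<oplus>)" \<zero> by fact
  have f: "f s \<in> M" and h: "0 \<le> h s" if "0 \<le> s" for s
    using assms that by auto
  show ?thesis
  proof (intro iffI)
    assume "\<forall>s\<in>{0..}. \<forall>t\<in>{0..}. f (s + t) = f s \<oplus> f (h s * t)"
    then have eq: "f (s + t) = f s \<oplus> f (h s * t)" if "0 \<le> s" "0 \<le> t" for s t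
      using that by simp
    obtain a where a: "a \<in> M" and f_eq: "\<And>s. 0 \<le> s \<Longrightarrow> f s = (if s \<in> Ker h then a else \<zero>)"
      and f0: "f 0 = \<zero>"
      using equation_imp_two_valued[OF assms(1,2) f h assms(6) eq] by blast
    have a_nz: "a \<noteq> \<zero>"
      using assms(4) f_eq by auto
    \<comment> \<open>Since \<open>a\<close> is not neutral, the kernel can be read off from
      \<open>f\<close>, which turns the equation into statements about \<open>Ker h\<close>.\<close>
    have Ker_f: "s \<in> Ker h \<longleftrightarrow> f s \<noteq> \<zero>" if "0 \<le> s" for s
      using f_eq[OF that] a_nz by simp
    have zero: "h 0 \<noteq> 0"
      using Ker_f[of 0] f0 by (simp add: Ker_iff)
    have up: "t \<in> Ker h" if "s \<in> Ker h" "s \<le> t" for s t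
      using that eq[of s "t - s"] f0 right_neutral f Ker_f[of s] Ker_f[of t] by (simp add: Ker_iff)
    have scale: "s + t \<in> Ker h \<longleftrightarrow> h s * t \<in> Ker h" if "0 \<le> s" "0 \<le> t" "h s \<noteq> 0" for s t
      using that eq[of s t] h[of s] f f_eq[of s] left_neutral Ker_f by (simp add: Ker_iff)
    have shape0: "h s = 0 \<longleftrightarrow> s \<noteq> 0" if "s0 = 0" "0 \<le> s" for s
      by (rule Ker_shape(1)) (fact h assms(6) up scale zero that[unfolded assms(7)])+
    have shape_pos: "h s = (if s < s0 then s0 / (s0 - s) else 0)" if "0 < s0" "0 \<le> s" for s
      unfolding assms(7)
      by (rule Ker_shape(2)) (fact h assms(6) up scale zero that[unfolded assms(7)])+
    consider "s0 = 0" | "0 < s0"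
      using Inf_Ker_nonneg[OF assms(6)] assms(7) by linarith
    then show "(s0 = 0 \<and> (\<exists>a\<in>M - {\<zero>}. \<exists>b\<in>{0<..}. \<forall>s\<in>{0..}.
          f s = (if s = 0 then \<zero> else a) \<and> h s = (if s = 0 then b else 0)))
      \<or> (s0 > 0 \<and> (\<exists>a\<in>M - {\<zero>}. \<forall>s\<in>{0..}.
          f s = (if s < s0 then \<zero> else a) \<and> h s = (if s < s0 then s0 / (s0 - s) else 0)))"
    proof cases
      case 1
      \<comment> \<open>The witness for \<open>b\<close> is \<open>h 0\<close>.\<close>
      have "\<forall>s\<in>{0..}. f s = (if s = 0 then \<zero> else a) \<and> h s = (if s = 0 then h 0 else 0)"
        using shape0[OF 1] f_eq by (auto simp: Ker_iff)
      moreover have "0 < h 0"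
        using h[of 0] zero by simp
      ultimately show ?thesis
        using 1 a a_nz by blast
    next
      case 2
      have "\<forall>s\<in>{0..}. f s = (if s < s0 then \<zero> else a) \<and>
          h s = (if s < s0 then s0 / (s0 - s) else 0)"
        using shape_pos[OF 2] f_eq 2 by (simp add: Ker_iff)
      then show ?thesis
        using 2 a a_nz by blast
    qed
  next
    assume "(s0 = 0 \<and> (\<exists>a\<in>M - {\<zero>}. \<exists>b\<in>{0<..}. \<forall>s\<in>{0..}.
          f s = (if s = 0 then \<zero> else a) \<and> h s = (if s = 0 then b else 0)))
      \<or> (s0 > 0 \<and> (\<exists>a\<in>M - {\<zero>}. \<forall>s\<in>{0..}.
          f s = (if s < s0 then \<zero> else a) \<and> h s = (if s < s0 then s0 / (s0 - s) else 0)))"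
    then consider
        a b where "a \<in> M" "0 < b"
          "\<And>s. 0 \<le> s \<Longrightarrow> f s = (if s = 0 then \<zero> else a) \<and> h s = (if s = 0 then b else 0)"
      | a where "a \<in> M" "0 < s0"
          "\<And>s. 0 \<le> s \<Longrightarrow>
            f s = (if s < s0 then \<zero> else a) \<and> h s = (if s < s0 then s0 / (s0 - s) else 0)"
      by auto
    then show "\<forall>s\<in>{0..}. \<forall>t\<in>{0..}. f (s + t) = f s \<oplus> f (h s * t)"
    proof cases
      case 1
      \<comment> \<open>For \<open>s = 0\<close>, \<open>b * t\<close> vanishes exactly when
        \<open>t\<close> does; for \<open>s > 0\<close> the second summand is
        \<open>f 0 = \<zero>\<close>.\<close>
      then show ?thesis
        using neutral_closed by (auto simp: left_neutral right_neutral)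
    next
      case (2 a)
      have "f (s + t) = f s \<oplus> f (h s * t)" if s: "0 \<le> s" and t: "0 \<le> t" for s t
      proof (cases "s < s0")
        case True
        \<comment> \<open>The factor rescales the threshold \<open>s0 - s\<close> for
          \<open>t\<close> to \<open>s0\<close>, so \<open>f\<close> takes the same value at both
          arguments.\<close>
        have "s0 / (s0 - s) * t < s0 \<longleftrightarrow> s + t < s0"
          using True 2(2) mult_less_cancel_left_pos[of s0 t "s0 - s"]
          by (simp add: pos_divide_less_eq less_diff_eq add.commute)
        moreover have "0 \<le> s0 / (s0 - s) * t"
          using True t s by simp
        ultimately show ?thesis
          using True 2(1) 2(3)[of s] 2(3)[of "s + t"] 2(3)[of "s0 / (s0 - s) * t"] s t
            neutral_closed left_neutral by simp
      next
        case False
        \<comment> \<open>Here \<open>h s = 0\<close>, and \<open>0 < s0\<close> gives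
          \<open>f 0 = \<zero>\<close>, so both sides equal \<open>a\<close>.\<close>
        then show ?thesis
          using 2(1,2) 2(3)[of s] 2(3)[of "s + t"] 2(3)[of 0] s t right_neutral by simp
      qed
      then show ?thesis
        by simp
    qed
  qed
qed

end
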